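(* Let $(X,\ast)$ be a pointed metric space. Then every surjective self-isometry of $X$ (not necessarily fixing $\ast$) extends in a unique way to a surjective affine self-isometry of $L(X,\ast)$, and likewise extends in a unique way to a surjective affine self-isometry of $B(X,\ast)$.
   Context: A pointed metric space $(X,d,\ast)$ is a metric space $(X,d)$ with a distinguished point $\ast\in X$. $L(X,\ast)$ is the real vector space having $X\setminus\{\ast\}$ as a Hamel basis and $\ast$ as zero, equipped with the largest seminorm $p$ such that $p(x-y)\le d(x,y)$ for all $x,y\in X$; this $p$ is a norm and induces the distance $d$ on $X\subseteq L(X,\ast)$. $B(X,\ast)$, the (Lipschitz-)free Banach space on $X$, is the Banach space completion of $L(X,\ast)$. *)

theory Defs
  imports "HOL-Analysis.Analysis"
begin

section \<open>The free normed space and the free Banach space of a pointed metric space\<close>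

definition seminorm :: "('v::real_vector \<Rightarrow> real) \<Rightarrow> bool" where
  "seminorm q \<longleftrightarrow>
     (\<forall>v. 0 \<le> q v) \<and> (\<forall>u v. q (u + v) \<le> q u + q v) \<and> (\<forall>a v. q (a *\<^sub>R v) = \<bar>a\<bar> * q v)"

text \<open>
  The space \<open>L(X, pt)\<close> depends on the point \<open>pt\<close>, so it is given by its defining properties:
  \<open>free_normed_space pt e\<close> says that the type \<open>'l\<close>, with \<open>X = 'a\<close> mapped into it by \<open>e\<close>, is
  \<open>L(X, pt)\<close>.  That the largest seminorm is a norm is part of the type class constraint on \<open>'l\<close>.
  Such a space exists for every \<open>pt\<close>, see \<open>free_normed_space_exists\<close> below.
\<close>

definition free_normed_space ::
    "'a::metric_space \<Rightarrow> ('a \<Rightarrow> 'l::real_normed_vector) \<Rightarrow> bool" where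
  "free_normed_space pt e \<longleftrightarrow>
     e pt = 0 \<and>
     inj_on e (- {pt}) \<and> independent (e ` (- {pt})) \<and> span (e ` (- {pt})) = UNIV \<and>
     (\<forall>x y. norm (e x - e y) \<le> dist x y) \<and>
     (\<forall>q. seminorm q \<and> (\<forall>x y. q (e x - e y) \<le> dist x y) \<longrightarrow> (\<forall>v. q v \<le> norm v))"

definition banach_completion :: "('l::real_normed_vector \<Rightarrow> 'b::banach) \<Rightarrow> bool" where
  "banach_completion j \<longleftrightarrow>
     linear j \<and> (\<forall>v. norm (j v) = norm v) \<and> closure (range j) = UNIV"

definition surjective_isometry :: "('m::metric_space \<Rightarrow> 'n::metric_space) \<Rightarrow> bool" where
  "surjective_isometry f \<longleftrightarrow> surj f \<and> (\<forall>x y. dist (f x) (f y) = dist x y)"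

definition affine_map :: "('v::real_vector \<Rightarrow> 'w::real_vector) \<Rightarrow> bool" where
  "affine_map F \<longleftrightarrow>
     (\<forall>u v t. F ((1 - t) *\<^sub>R u + t *\<^sub>R v) = (1 - t) *\<^sub>R F u + t *\<^sub>R F v)"


section \<open>Existence of the free normed space\<close>

text \<open>
  Finitely supported functions of total mass \<open>0\<close>: one space that serves for every base point,
  \<open>x\<close> being represented by the difference of the point masses at \<open>x\<close> and at \<open>pt\<close>.
\<close>

definition molecules :: "('a \<Rightarrow> real) set" where
  "molecules = {f. \<exists>A. finite A \<and> (\<forall>x. x \<notin> A \<longrightarrow> f x = 0) \<and> sum f A = 0}"

lemma moleculesI:
  "finite A \<Longrightarrow> (\<And>x. x \<notin> A \<Longrightarrow> f x = 0) \<Longrightarrow> sum f A = 0 \<Longrightarrow> f \<in> molecules"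
  by (auto simp: molecules_def)

typedef (overloaded) ('a::metric_space) molecule = "molecules :: ('a \<Rightarrow> real) set"
  morphisms mass Abs_molecule
  by (rule exI[of _ "\<lambda>_. 0"]) (rule moleculesI[of "{}"]; simp)

setup_lifting type_definition_molecule

lemma molecules_scale: "f \<in> molecules \<Longrightarrow> (\<lambda>x. a * f x) \<in> molecules"
  by (auto simp: molecules_def sum_distrib_left[symmetric])

lemma molecules_add:
  assumes "f \<in> molecules" "g \<in> molecules"
  shows "(\<lambda>x. f x + g x) \<in> molecules"
proof -
  obtain A B where A: "finite A" "\<forall>x. x \<notin> A \<longrightarrow> f x = 0" "sum f A = 0"
    and B: "finite B" "\<forall>x. x \<notin> B \<longrightarrow> g x = 0" "sum g B = 0"
    using assms unfolding molecules_def by blast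
  have "sum f A = sum f (A \<union> B)" "sum g B = sum g (A \<union> B)"
    using A B by (intro sum.mono_neutral_left; auto)+
  with A B show ?thesis
    by (intro moleculesI[of "A \<union> B"]) (auto simp: sum.distrib)
qed

instantiation molecule :: (metric_space) real_vector
begin

lift_definition zero_molecule :: "'a molecule" is "\<lambda>_. 0"
  by (rule moleculesI[of "{}"]) auto
lift_definition plus_molecule :: "'a molecule \<Rightarrow> 'a molecule \<Rightarrow> 'a molecule" is "\<lambda>f g x. f x + g x"
  by (rule molecules_add)
lift_definition uminus_molecule :: "'a molecule \<Rightarrow> 'a molecule" is "\<lambda>f x. - f x"
  using molecules_scale[of _ "-1"] by simp
lift_definition minus_molecule :: "'a molecule \<Rightarrow> 'a molecule \<Rightarrow> 'a molecule" is "\<lambda>f g x. f x - g x"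
  using molecules_add[OF _ molecules_scale[of _ "-1"]] by simp
lift_definition scaleR_molecule :: "real \<Rightarrow> 'a molecule \<Rightarrow> 'a molecule" is "\<lambda>a f x. a * f x"
  by (rule molecules_scale)

instance
  by standard (transfer; auto simp: algebra_simps)+

end

lift_definition dipole :: "'a::metric_space \<Rightarrow> 'a \<Rightarrow> 'a molecule"
  is "\<lambda>x y z. of_bool (z = x) - of_bool (z = y)"
  subgoal for x y by (rule moleculesI[of "{x, y}"]) (cases "x = y"; auto)+
  done

lemma dipole_diff: "dipole x z - dipole y z = dipole x y"
  by transfer auto

lemma mass_sum: "mass (sum g A) z = (\<Sum>x\<in>A. mass (g x) z)"
  by (induction A rule: infinite_finite_induct) (simp_all add: zero_molecule.rep_eq plus_molecule.rep_eq)

lemma molecule_expand: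
  obtains A where "finite A" "m = (\<Sum>x\<in>A. mass m x *\<^sub>R dipole x p)"
proof -
  obtain A where A: "finite A" "\<And>x. x \<notin> A \<Longrightarrow> mass m x = 0" "sum (mass m) A = 0"
    using mass[of m] by (auto simp: molecules_def)
  have "m = (\<Sum>x\<in>A. mass m x *\<^sub>R dipole x p)"
  proof (rule mass_inject[THEN iffD1], rule ext)
    fix z
    have "(\<Sum>x\<in>A. mass m x * of_bool (z = x)) = mass m z"
      using A by (cases "z \<in> A") (auto simp: of_bool_def if_distrib sum.delta cong: if_cong)
    moreover have "(\<Sum>x\<in>A. mass m x * of_bool (z = p)) = 0"
      using A(3) by (simp add: sum_distrib_right[symmetric])
    ultimately show "mass m z = mass (\<Sum>x\<in>A. mass m x *\<^sub>R dipole x p) z"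
      by (simp add: mass_sum scaleR_molecule.rep_eq dipole.rep_eq right_diff_distrib sum_subtractf)
  qed
  with A(1) show ?thesis by (rule that)
qed

definition admissible :: "('a::metric_space molecule \<Rightarrow> real) \<Rightarrow> bool" where
  "admissible q \<longleftrightarrow> seminorm q \<and> (\<forall>x y. q (dipole x y) \<le> dist x y)"

lemma admissible_zero: "admissible (\<lambda>_. 0)"
  by (simp add: admissible_def seminorm_def)

lemma seminorm_sum: "seminorm q \<Longrightarrow> q (sum g A) \<le> (\<Sum>x\<in>A. q (g x))"
proof (induction A rule: infinite_finite_induct)
  case (insert x A)
  then have "q (g x + sum g A) \<le> q (g x) + q (sum g A)" by (simp add: seminorm_def)
  with insert show ?case by auto
next
  case empty
  then have "q (0 *\<^sub>R 0) = \<bar>0\<bar> * q 0" unfolding seminorm_def by blast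
  then show ?case by simp
next
  case (infinite A)
  then have "q (0 *\<^sub>R 0) = \<bar>0\<bar> * q 0" unfolding seminorm_def by blast
  with infinite show ?case by simp
qed

lemma admissible_bdd: "bdd_above {q m | q. admissible q}"
proof -
  obtain p :: 'a where True by blast
  obtain A where A: "finite A" "m = (\<Sum>x\<in>A. mass m x *\<^sub>R dipole x p)"
    by (rule molecule_expand)
  have "q m \<le> (\<Sum>x\<in>A. \<bar>mass m x\<bar> * dist x p)" if "admissible q" for q
  proof -
    have q: "seminorm q" "\<And>x y. q (dipole x y) \<le> dist x y"
      using that by (auto simp: admissible_def)
    have "q m \<le> (\<Sum>x\<in>A. q (mass m x *\<^sub>R dipole x p))"
      using seminorm_sum[OF q(1), of "\<lambda>x. mass m x *\<^sub>R dipole x p" A] A(2) by simp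
    also have "\<dots> \<le> (\<Sum>x\<in>A. \<bar>mass m x\<bar> * dist x p)"
      using q by (intro sum_mono) (auto simp: seminorm_def intro: mult_left_mono)
    finally show ?thesis .
  qed
  then show ?thesis by (intro bdd_aboveI) auto
qed

lemma admissible_separates:
  assumes "m \<noteq> 0"
  obtains q where "admissible q" "q m > 0"
proof -
  have "mass m \<noteq> mass 0" using assms mass_inject by blast
  then obtain x where x: "mass m x \<noteq> 0" by (auto simp: zero_molecule.rep_eq)
  obtain A where A: "finite A" "\<And>y. y \<notin> A \<Longrightarrow> mass m y = 0"
    using mass[of m] by (auto simp: molecules_def)
  obtain r where r: "r > 0" "\<And>y. y \<in> A \<Longrightarrow> y \<noteq> x \<Longrightarrow> r \<le> dist x y"
    using finite_set_avoid[OF A(1), of x] by blast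
  define h where "h y = max 0 (r - dist x y)" for y
  define supp where "supp m' = {y. mass m' y \<noteq> 0}" for m' :: "'a molecule"
  have fin: "finite (supp m')" for m'
  proof -
    obtain B where "finite B" "\<And>y. y \<notin> B \<Longrightarrow> mass m' y = 0"
      using mass[of m'] by (auto simp: molecules_def)
    then show ?thesis unfolding supp_def by (metis (mono_tags, lifting) finite_subset mem_Collect_eq subsetI)
  qed
  define T where "T m' = (\<Sum>y\<in>supp m'. mass m' y * h y)" for m'
  have T: "T m' = (\<Sum>y\<in>B. mass m' y * h y)" if "finite B" "\<And>y. y \<notin> B \<Longrightarrow> mass m' y = 0" for B m'
    unfolding T_def using that by (intro sum.mono_neutral_left) (auto simp: supp_def)
  have T_add: "T (u + v) = T u + T v" for u v
  proof -
    let ?B = "supp u \<union> supp v"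
    have "T u = (\<Sum>y\<in>?B. mass u y * h y)" "T v = (\<Sum>y\<in>?B. mass v y * h y)"
      "T (u + v) = (\<Sum>y\<in>?B. mass (u + v) y * h y)"
      by (intro T; use fin in \<open>auto simp: supp_def plus_molecule.rep_eq\<close>)+
    then show ?thesis by (simp add: plus_molecule.rep_eq sum.distrib distrib_right)
  qed
  have T_scale: "T (a *\<^sub>R v) = a * T v" for a v
  proof -
    have "T (a *\<^sub>R v) = (\<Sum>y\<in>supp v. mass (a *\<^sub>R v) y * h y)"
      by (intro T) (use fin in \<open>auto simp: supp_def scaleR_molecule.rep_eq\<close>)
    then show ?thesis by (simp add: T_def scaleR_molecule.rep_eq sum_distrib_left mult.assoc)
  qed
  have T_dipole: "T (dipole y z) = h y - h z" for y z
  proof -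
    have "T (dipole y z) = (\<Sum>w\<in>{y, z}. mass (dipole y z) w * h w)"
      by (intro T) (auto simp: dipole.rep_eq)
    then show ?thesis by (cases "y = z") (auto simp: dipole.rep_eq)
  qed
  have lip: "\<bar>h y - h z\<bar> \<le> dist y z" for y z
    unfolding h_def using dist_triangle[of x y z] dist_triangle[of x z y]
    by (auto simp: dist_commute max_def abs_if)
  have "admissible (\<lambda>v. \<bar>T v\<bar>)"
    by (auto simp: admissible_def seminorm_def T_add T_scale abs_mult T_dipole lip)
  moreover have "T m = mass m x * r"
  proof -
    have "T m = (\<Sum>y\<in>insert x A. mass m y * h y)"
      using A by (intro T) auto
    also have "\<dots> = (\<Sum>y\<in>{x}. mass m y * h y)"
      using A r by (intro sum.mono_neutral_right) (auto simp: h_def)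
    finally show ?thesis using r by (simp add: h_def)
  qed
  ultimately show ?thesis using that[of "\<lambda>v. \<bar>T v\<bar>"] x r by auto
qed

instantiation molecule :: (metric_space) real_normed_vector
begin

definition norm_molecule :: "'a molecule \<Rightarrow> real" where
  "norm_molecule m = Sup {q m | q. admissible q}"

definition dist_molecule :: "'a molecule \<Rightarrow> 'a molecule \<Rightarrow> real" where
  "dist_molecule u v = norm (u - v)"

definition sgn_molecule :: "'a molecule \<Rightarrow> 'a molecule" where
  "sgn_molecule v = v /\<^sub>R norm v"

definition uniformity_molecule :: "('a molecule \<times> 'a molecule) filter" where
  "uniformity_molecule = (INF e\<in>{0 <..}. principal {(x, y). dist x y < e})"

definition open_molecule :: "'a molecule set \<Rightarrow> bool" where
  "open_molecule U \<longleftrightarrow> (\<forall>x\<in>U. \<forall>\<^sub>F (x', y) in uniformity. x' = x \<longrightarrow> y \<in> U)"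

instance
proof
  have upper: "q m \<le> norm m" if "admissible q" for q and m :: "'a molecule"
    unfolding norm_molecule_def using that admissible_bdd by (intro cSup_upper) auto
  have least: "norm m \<le> b" if "\<And>q. admissible q \<Longrightarrow> q m \<le> b" for m :: "'a molecule" and b
    unfolding norm_molecule_def using that admissible_zero by (intro cSup_least) auto
  have admD: "q (u + v) \<le> q u + q v" "q (a *\<^sub>R v) = \<bar>a\<bar> * q v" if "admissible q"
    for q and u v :: "'a molecule" and a
    using that by (auto simp: admissible_def seminorm_def)
  fix a :: real and x y :: "'a molecule"
  have sc: "norm (c *\<^sub>R v) \<le> \<bar>c\<bar> * norm v" for c and v :: "'a molecule"
    by (rule least) (auto simp: admD intro: mult_left_mono upper)
  have z: "norm (0 :: 'a molecule) = 0"
    using sc[of 0 0] upper[OF admissible_zero, of 0] by simp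
  show "norm (x + y) \<le> norm x + norm y"
    by (rule least) (meson add_mono admD(1) order_trans upper)
  show "norm (a *\<^sub>R x) = \<bar>a\<bar> * norm x"
  proof (cases "a = 0")
    case False
    have "norm x \<le> \<bar>inverse a\<bar> * norm (a *\<^sub>R x)"
      using sc[of "inverse a" "a *\<^sub>R x"] False by simp
    then have "\<bar>a\<bar> * norm x \<le> norm (a *\<^sub>R x)"
      using False by (simp add: field_simps)
    with sc[of a x] show ?thesis by simp
  qed (simp add: z)
  show "norm x = 0 \<longleftrightarrow> x = 0"
    using z admissible_separates[of x] upper by (metis leD)
qed (simp_all add: dist_molecule_def sgn_molecule_def uniformity_molecule_def open_molecule_def)

end

lemma norm_molecule_upper: "admissible q \<Longrightarrow> q m \<le> norm m"
  unfolding norm_molecule_def using admissible_bdd by (intro cSup_upper) auto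

lemma norm_molecule_least: "(\<And>q. admissible q \<Longrightarrow> q m \<le> b) \<Longrightarrow> norm m \<le> b"
  unfolding norm_molecule_def using admissible_zero by (intro cSup_least) auto

lemma free_normed_space_exists:
  fixes pt :: "'a::metric_space"
  shows "\<exists>e :: 'a \<Rightarrow> 'a molecule. free_normed_space pt e"
proof
  let ?e = "\<lambda>x. dipole x pt" and ?B = "(\<lambda>x. dipole x pt) ` (- {pt})"
  have 0: "dipole pt pt = 0" by transfer simp
  have mass_e: "mass (dipole x pt) z = of_bool (z = x)" if "z \<noteq> pt" for x z
    using that by (simp add: dipole.rep_eq)
  have inj: "inj_on ?e (- {pt})"
    by (rule inj_onI) (metis ComplD insertI1 mass_e of_bool_eq(1,2) zero_neq_one)
  have ind: "independent ?B"
  proof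
    assume "dependent ?B"
    then obtain t u v where t: "finite t" "t \<subseteq> ?B" "(\<Sum>w\<in>t. u w *\<^sub>R w) = 0" "v \<in> t" "u v \<noteq> 0"
      unfolding dependent_explicit by blast
    then obtain x where x: "x \<noteq> pt" "v = dipole x pt" by auto
    have "0 = mass (\<Sum>w\<in>t. u w *\<^sub>R w) x"
      using t(3) by (simp add: zero_molecule.rep_eq)
    also have "\<dots> = (\<Sum>w\<in>t. u w * mass w x)"
      by (simp add: mass_sum scaleR_molecule.rep_eq)
    also have "\<dots> = (\<Sum>w\<in>{v}. u w * mass w x)"
    proof (rule sum.mono_neutral_right)
      show "\<forall>w\<in>t - {v}. u w * mass w x = 0"
      proof
        fix w assume "w \<in> t - {v}"
        then obtain y where "w = dipole y pt" "y \<noteq> x" using t(2) x by blast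
        then show "u w * mass w x = 0" using x mass_e by simp
      qed
    qed (use t in auto)
    also have "\<dots> = u v" using x mass_e by simp
    finally show False using t(5) by simp
  qed
  have sp: "span ?B = UNIV"
  proof -
    have "m \<in> span ?B" for m
    proof -
      obtain A where A: "m = (\<Sum>x\<in>A. mass m x *\<^sub>R dipole x pt)"
        by (rule molecule_expand)
      have "dipole x pt \<in> span ?B" for x
        by (cases "x = pt") (auto simp: 0 span_zero intro: span_base)
      then have "(\<Sum>x\<in>A. mass m x *\<^sub>R dipole x pt) \<in> span ?B"
        by (intro span_sum span_scale)
      with A show ?thesis by simp
    qed
    then show ?thesis by auto
  qed
  have "norm (dipole x y) \<le> dist x y" for x y :: 'a
    by (rule norm_molecule_least) (simp add: admissible_def)
  moreover have "q v \<le> norm v" if "seminorm q" "\<forall>x y. q (dipole x y) \<le> dist x y"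
    for q and v :: "'a molecule"
    by (rule norm_molecule_upper) (simp add: admissible_def that)
  ultimately show "free_normed_space pt ?e"
    using 0 inj ind sp unfolding free_normed_space_def dipole_diff by blast
qed


section \<open>Existence of the completion\<close>

text \<open>Cauchy sequences modulo null sequences.\<close>

definition cauchy_equiv :: "(nat \<Rightarrow> 'l::real_normed_vector) \<Rightarrow> (nat \<Rightarrow> 'l) \<Rightarrow> bool" where
  "cauchy_equiv X Y \<longleftrightarrow> Cauchy X \<and> Cauchy Y \<and> (\<lambda>n. X n - Y n) \<longlonglongrightarrow> 0"

lemma part_equivp_cauchy_equiv: "part_equivp cauchy_equiv"
proof (rule part_equivpI)
  show "\<exists>X. cauchy_equiv X X"
    by (rule exI[of _ "\<lambda>_. 0"]) (simp add: cauchy_equiv_def convergent_Cauchy convergent_const)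
  show "symp cauchy_equiv"
    using tendsto_minus by (force simp: symp_def cauchy_equiv_def)
  show "transp cauchy_equiv"
    using tendsto_add by (force simp: transp_def cauchy_equiv_def)
qed

quotient_type (overloaded) 'l completion =
  "nat \<Rightarrow> 'l::real_normed_vector" / partial: cauchy_equiv
  by (rule part_equivp_cauchy_equiv)

lemma Cauchy_plus:
  fixes X Y :: "nat \<Rightarrow> 'l::real_normed_vector"
  assumes "Cauchy X" "Cauchy Y"
  shows "Cauchy (\<lambda>n. X n + Y n)"
proof (rule CauchyI)
  fix r :: real assume "r > 0"
  then have r2: "0 < r / 2" by simp
  obtain M where M: "\<forall>m\<ge>M. \<forall>n\<ge>M. norm (X m - X n) < r / 2"
    using CauchyD[OF assms(1) r2] by blast
  obtain N where N: "\<forall>m\<ge>N. \<forall>n\<ge>N. norm (Y m - Y n) < r / 2"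
    using CauchyD[OF assms(2) r2] by blast
  have "norm (X m + Y m - (X n + Y n)) < r" if "m \<ge> max M N" "n \<ge> max M N" for m n
  proof -
    have "norm ((X m - X n) + (Y m - Y n)) \<le> norm (X m - X n) + norm (Y m - Y n)"
      by (rule norm_triangle_ineq)
    also have "\<dots> < r / 2 + r / 2"
      using M N that by (intro add_strict_mono) auto
    finally show ?thesis by (simp add: add_diff_add)
  qed
  then show "\<exists>M. \<forall>m\<ge>M. \<forall>n\<ge>M. norm (X m + Y m - (X n + Y n)) < r" by blast
qed

lemma Cauchy_scale:
  fixes X :: "nat \<Rightarrow> 'l::real_normed_vector"
  shows "Cauchy X \<Longrightarrow> Cauchy (\<lambda>n. a *\<^sub>R X n)"
  by (rule bounded_linear.Cauchy[OF bounded_linear_scaleR_right])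

lemma Cauchy_neg: "Cauchy X \<Longrightarrow> Cauchy (\<lambda>n. - X n :: 'l::real_normed_vector)"
  using Cauchy_scale[of X "-1"] by simp

lemma convergent_norm_Cauchy:
  fixes X :: "nat \<Rightarrow> 'l::real_normed_vector"
  assumes "Cauchy X"
  shows "convergent (\<lambda>n. norm (X n))"
proof (rule Cauchy_convergent, rule CauchyI)
  fix r :: real assume "r > 0"
  then obtain M where M: "\<forall>m\<ge>M. \<forall>n\<ge>M. norm (X m - X n) < r"
    using assms CauchyD by blast
  have "norm (norm (X m) - norm (X n)) < r" if "m \<ge> M" "n \<ge> M" for m n
    using M that le_less_trans[OF norm_triangle_ineq3[of "X m" "X n"]] by simp
  then show "\<exists>M. \<forall>m\<ge>M. \<forall>n\<ge>M. norm (norm (X m) - norm (X n)) < r" by blast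
qed

lemma norm_tendsto_lim:
  "Cauchy X \<Longrightarrow> (\<lambda>n. norm (X n :: 'l::real_normed_vector)) \<longlonglongrightarrow> lim (\<lambda>n. norm (X n))"
  using convergent_norm_Cauchy convergent_LIMSEQ_iff by blast

lemma cauchy_equiv_add:
  "cauchy_equiv X X' \<Longrightarrow> cauchy_equiv Y Y' \<Longrightarrow> cauchy_equiv (\<lambda>n. X n + Y n) (\<lambda>n. X' n + Y' n)"
  using tendsto_add[of "\<lambda>n. X n - X' n" 0 sequentially "\<lambda>n. Y n - Y' n" 0]
  by (auto simp: cauchy_equiv_def Cauchy_plus add_diff_add)

lemma cauchy_equiv_scale:
  "cauchy_equiv X X' \<Longrightarrow> cauchy_equiv (\<lambda>n. a *\<^sub>R X n) (\<lambda>n. a *\<^sub>R X' n)"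
  using tendsto_scaleR[OF tendsto_const[of a], of "\<lambda>n. X n - X' n" 0 sequentially]
  by (auto simp: cauchy_equiv_def Cauchy_scale scaleR_diff_right)

lemma cauchy_equiv_neg: "cauchy_equiv X X' \<Longrightarrow> cauchy_equiv (\<lambda>n. - X n) (\<lambda>n. - X' n)"
  using cauchy_equiv_scale[of X X' "-1"] by simp

lemma cauchy_equiv_self: "cauchy_equiv X X \<longleftrightarrow> Cauchy X"
  by (simp add: cauchy_equiv_def)

lemma cauchy_equiv_norm:
  assumes "cauchy_equiv X Y"
  shows "lim (\<lambda>n. norm (X n)) = lim (\<lambda>n. norm (Y n))"
proof -
  have "(\<lambda>n. norm (X n) - norm (Y n)) \<longlonglongrightarrow> 0"
    by (rule Lim_null_comparison[of _ "\<lambda>n. norm (X n - Y n)"])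
      (use assms in \<open>auto simp: cauchy_equiv_def norm_triangle_ineq3 intro: tendsto_norm_zero\<close>)
  moreover have "(\<lambda>n. norm (X n) - norm (Y n)) \<longlonglongrightarrow> lim (\<lambda>n. norm (X n)) - lim (\<lambda>n. norm (Y n))"
    using assms by (intro tendsto_diff norm_tendsto_lim) (auto simp: cauchy_equiv_def)
  ultimately show ?thesis using LIMSEQ_unique by fastforce
qed

instantiation completion :: (real_normed_vector) real_vector
begin

lift_definition zero_completion :: "'a completion" is "\<lambda>_. 0"
  by (simp add: cauchy_equiv_self convergent_Cauchy convergent_const)
lift_definition plus_completion :: "'a completion \<Rightarrow> 'a completion \<Rightarrow> 'a completion"
  is "\<lambda>X Y n. X n + Y n"
  by (rule cauchy_equiv_add)
lift_definition uminus_completion :: "'a completion \<Rightarrow> 'a completion" is "\<lambda>X n. - X n"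
  by (rule cauchy_equiv_neg)
lift_definition minus_completion :: "'a completion \<Rightarrow> 'a completion \<Rightarrow> 'a completion"
  is "\<lambda>X Y n. X n - Y n"
  using cauchy_equiv_add[OF _ cauchy_equiv_neg] by simp
lift_definition scaleR_completion :: "real \<Rightarrow> 'a completion \<Rightarrow> 'a completion" is "\<lambda>a X n. a *\<^sub>R X n"
  by (rule cauchy_equiv_scale)

instance
proof
  fix a b :: real and x y z :: "'a completion"
  show "x + y + z = x + (y + z)"
    by transfer (simp add: cauchy_equiv_self Cauchy_plus add.assoc)
  show "x + y = y + x"
    by transfer (simp add: cauchy_equiv_self Cauchy_plus add.commute)
  show "0 + x = x"
    by transfer (simp add: cauchy_equiv_self)
  show "- x + x = 0"
    by transfer (simp add: cauchy_equiv_self convergent_Cauchy convergent_const)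
  show "x - y = x + - y"
    by transfer (use Cauchy_plus Cauchy_neg in \<open>force simp: cauchy_equiv_self\<close>)
  show "a *\<^sub>R (x + y) = a *\<^sub>R x + a *\<^sub>R y"
    by transfer (simp add: cauchy_equiv_self Cauchy_plus Cauchy_scale scaleR_add_right)
  show "(a + b) *\<^sub>R x = a *\<^sub>R x + b *\<^sub>R x"
    by transfer (simp add: cauchy_equiv_self Cauchy_plus Cauchy_scale scaleR_add_left)
  show "a *\<^sub>R b *\<^sub>R x = (a * b) *\<^sub>R x"
    by transfer (simp add: cauchy_equiv_self Cauchy_scale)
  show "1 *\<^sub>R x = x"
    by transfer (simp add: cauchy_equiv_self)
qed

end

instantiation completion :: (real_normed_vector) real_normed_vector
begin

lift_definition norm_completion :: "'a completion \<Rightarrow> real" is "\<lambda>X. lim (\<lambda>n. norm (X n))"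
  by (rule cauchy_equiv_norm)

definition dist_completion :: "'a completion \<Rightarrow> 'a completion \<Rightarrow> real" where
  "dist_completion u v = norm (u - v)"

definition sgn_completion :: "'a completion \<Rightarrow> 'a completion" where
  "sgn_completion v = v /\<^sub>R norm v"

definition uniformity_completion :: "('a completion \<times> 'a completion) filter" where
  "uniformity_completion = (INF e\<in>{0 <..}. principal {(x, y). dist x y < e})"

definition open_completion :: "'a completion set \<Rightarrow> bool" where
  "open_completion U \<longleftrightarrow> (\<forall>x\<in>U. \<forall>\<^sub>F (x', y) in uniformity. x' = x \<longrightarrow> y \<in> U)"

instance
proof
  fix a :: real and x y :: "'a completion"
  show "norm x = 0 \<longleftrightarrow> x = 0"
  proof transfer
    fix X :: "nat \<Rightarrow> 'a" assume "cauchy_equiv X X"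
    then have X: "Cauchy X" by (simp add: cauchy_equiv_self)
    show "lim (\<lambda>n. norm (X n)) = 0 \<longleftrightarrow> cauchy_equiv X (\<lambda>_. 0)"
    proof
      assume "lim (\<lambda>n. norm (X n)) = 0"
      then have "X \<longlonglongrightarrow> 0" using norm_tendsto_lim[OF X] tendsto_norm_zero_cancel by force
      then show "cauchy_equiv X (\<lambda>_. 0)"
        using X by (simp add: cauchy_equiv_def convergent_Cauchy convergent_const)
    next
      assume "cauchy_equiv X (\<lambda>_. 0)"
      from cauchy_equiv_norm[OF this] show "lim (\<lambda>n. norm (X n)) = 0" by simp
    qed
  qed
  show "norm (x + y) \<le> norm x + norm y"
  proof transfer
    fix X Y :: "nat \<Rightarrow> 'a" assume "cauchy_equiv X X" "cauchy_equiv Y Y"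
    then have "Cauchy X" "Cauchy Y" by (simp_all add: cauchy_equiv_self)
    then show "lim (\<lambda>n. norm (X n + Y n)) \<le> lim (\<lambda>n. norm (X n)) + lim (\<lambda>n. norm (Y n))"
      by (intro LIMSEQ_le[OF norm_tendsto_lim tendsto_add[OF norm_tendsto_lim norm_tendsto_lim]])
        (auto intro: Cauchy_plus norm_triangle_ineq)
  qed
  show "norm (a *\<^sub>R x) = \<bar>a\<bar> * norm x"
  proof transfer
    fix a and X :: "nat \<Rightarrow> 'a" assume "cauchy_equiv X X"
    then have "(\<lambda>n. \<bar>a\<bar> * norm (X n)) \<longlonglongrightarrow> \<bar>a\<bar> * lim (\<lambda>n. norm (X n))"
      by (intro tendsto_intros norm_tendsto_lim) (simp add: cauchy_equiv_self)
    then show "lim (\<lambda>n. norm (a *\<^sub>R X n)) = \<bar>a\<bar> * lim (\<lambda>n. norm (X n))"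
      by (simp add: limI)
  qed
qed (simp_all add: dist_completion_def sgn_completion_def uniformity_completion_def open_completion_def)

end

lift_definition to_completion :: "'l::real_normed_vector \<Rightarrow> 'l completion" is "\<lambda>v _. v"
  by (simp add: cauchy_equiv_self convergent_Cauchy convergent_const)

lemma norm_to_completion: "norm (to_completion v) = norm v"
  by transfer simp

lemma linear_to_completion: "linear to_completion"
  by (rule linearI; transfer; simp add: cauchy_equiv_self convergent_Cauchy convergent_const)

lemma Cauchy_tendsto_completion:
  fixes X :: "nat \<Rightarrow> 'l::real_normed_vector"
  assumes "Cauchy X"
  shows "(\<lambda>n. to_completion (X n)) \<longlonglongrightarrow> abs_completion X"
proof (rule metric_LIMSEQ_I)
  fix r :: real assume "r > 0"
  then obtain M where M: "\<forall>m\<ge>M. \<forall>n\<ge>M. norm (X m - X n) < r / 2"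
    using assms CauchyD[of X "r / 2"] by auto
  have "dist (to_completion (X n)) (abs_completion X) < r" if "n \<ge> M" for n
  proof -
    have eq: "norm (to_completion (X n) - abs_completion X) = lim (\<lambda>m. norm (X n - X m))"
      using assms
      by (simp add: to_completion.abs_eq minus_completion.abs_eq norm_completion.abs_eq
          cauchy_equiv_self convergent_Cauchy convergent_const Cauchy_plus[OF _ Cauchy_neg, simplified])
    have "Cauchy (\<lambda>m. X n - X m)"
      using Cauchy_plus[OF _ Cauchy_neg[OF assms], of "\<lambda>_. X n"]
      by (simp add: convergent_Cauchy convergent_const)
    then have "lim (\<lambda>m. norm (X n - X m)) \<le> r / 2"
      by (intro LIMSEQ_le_const2[OF norm_tendsto_lim]) (use M that in \<open>auto intro!: exI[of _ M] less_imp_le\<close>)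
    with eq \<open>r > 0\<close> show ?thesis by (simp add: dist_completion_def)
  qed
  then show "\<exists>M. \<forall>n\<ge>M. dist (to_completion (X n)) (abs_completion X) < r" by blast
qed

lemma completion_approx:
  fixes x :: "'l::real_normed_vector completion"
  assumes "r > 0"
  shows "\<exists>v. dist (to_completion v) x < r"
proof -
  obtain X where "x = abs_completion X" "Cauchy X"
    by (metis Quotient3_completion Quotient3_def cauchy_equiv_self)
  then have "(\<lambda>n. to_completion (X n)) \<longlonglongrightarrow> x" using Cauchy_tendsto_completion by blast
  with assms show ?thesis by (meson metric_LIMSEQ_D order_refl)
qed

instance completion :: (real_normed_vector) banach
proof
  fix S :: "nat \<Rightarrow> 'a completion" assume S: "Cauchy S"
  have "\<forall>n. \<exists>v. dist (to_completion v) (S n) < 1 / real (Suc n)"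
    by (intro allI completion_approx) simp
  then obtain y where y: "\<And>n. dist (to_completion (y n)) (S n) < 1 / real (Suc n)"
    by metis
  have null: "(\<lambda>n. to_completion (y n) - S n) \<longlonglongrightarrow> 0"
    by (rule Lim_null_comparison[OF _ LIMSEQ_inverse_real_of_nat])
      (use y in \<open>auto simp: dist_norm divide_inverse less_imp_le\<close>)
  have "Cauchy (\<lambda>n. (to_completion (y n) - S n) + S n)"
    by (rule Cauchy_plus[OF _ S]) (use null in \<open>auto intro: LIMSEQ_imp_Cauchy\<close>)
  then have "Cauchy (\<lambda>n. to_completion (y n))" by simp
  moreover have "norm (to_completion u - to_completion v) = norm (u - v)" for u v :: 'a
    by (metis linear_diff linear_to_completion norm_to_completion)
  ultimately have "Cauchy y" by (simp add: Cauchy_iff)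
  from tendsto_diff[OF Cauchy_tendsto_completion[OF this] null]
  have "S \<longlonglongrightarrow> abs_completion y" by simp
  then show "convergent S" by (rule convergentI)
qed

lemma banach_completion_exists: "\<exists>j :: 'l::real_normed_vector \<Rightarrow> 'l completion. banach_completion j"
proof -
  have "closure (range to_completion) = (UNIV :: 'l completion set)"
    using completion_approx by (auto simp: closure_approachable)
  then show ?thesis
    unfolding banach_completion_def using linear_to_completion norm_to_completion by blast
qed

end

theory Submission
  imports Defs
begin

text \<open>
  The space \<open>L(X, pt)\<close> has a universal property: a nonexpansive map \<open>h\<close> from \<open>X\<close> to a normed
  space, with \<open>h pt = 0\<close>, is the restriction of a nonexpansive linear map.  Indeed, linear
  extension from the Hamel basis gives a map \<open>T\<close>, and \<open>v \<mapsto> norm (T v)\<close> is one of the seminorms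
  that the norm of \<open>L(X, pt)\<close> dominates.

  A surjective isometry \<open>f\<close> of \<open>X\<close> may move the base point, so the property is applied to
  \<open>x \<mapsto> e (f x) - e (f pt)\<close>; the same is done for the inverse of \<open>f\<close>.  The two linear maps are
  inverse to each other, because they are so on the points of \<open>X\<close>, which span.  Nonexpansive maps
  that are inverse to each other are isometries, and adding the vector \<open>e (f pt)\<close> back yields the
  required affine isometry of \<open>L(X, pt)\<close>.  It is unique because an affine map is determined by
  its values at \<open>0\<close> (which is the base point) and on a spanning set.

  The Banach space contains \<open>L(X, pt)\<close> as a dense subset.  An isometry between dense subsets of
  complete metric spaces extends to the completions, being uniformly continuous; extending its
  inverse too shows that the extension is onto.  Since isometries are continuous, the affine
  identity for the extension, and its uniqueness, follow by density.
\<close>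


section \<open>Affine maps\<close>

text \<open>
  Homogeneity is the affine identity on the line through \<open>0\<close> and \<open>v\<close>; additivity then follows
  since \<open>u + v\<close> is the midpoint of \<open>2u\<close> and \<open>2v\<close>.
\<close>

lemma affine_map_linear_part:
  fixes F :: "'v::real_vector \<Rightarrow> 'w::real_vector"
  assumes "affine_map F"
  shows "linear (\<lambda>v. F v - F 0)"
proof -
  have F: "F ((1 - t) *\<^sub>R u + t *\<^sub>R v) = (1 - t) *\<^sub>R F u + t *\<^sub>R F v" for u v t
    using assms by (simp add: affine_map_def)
  have scale: "F (t *\<^sub>R v) = (1 - t) *\<^sub>R F 0 + t *\<^sub>R F v" for t v
    using F[of t 0 v] by simp
  have add: "F (u + v) - F 0 = (F u - F 0) + (F v - F 0)" for u v
  proof -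
    have "F (u + v) = (1/2) *\<^sub>R F (2 *\<^sub>R u) + (1/2) *\<^sub>R F (2 *\<^sub>R v)"
      using F[of "1/2" "2 *\<^sub>R u" "2 *\<^sub>R v"] by simp
    also have "\<dots> = F u + F v - F 0"
      using scaleR_half_double[of "F 0"]
      by (simp add: scale[of 2 u] scale[of 2 v] algebra_simps)
    finally show ?thesis by simp
  qed
  show ?thesis
    by (rule linearI) (simp_all only: add scale, simp add: algebra_simps)
qed

lemma affine_map_translate_linear:
  assumes "linear T"
  shows "affine_map (\<lambda>v. c + T v)"
  unfolding affine_map_def
  by (simp add: linear_add[OF assms] linear_scale[OF assms] linear_diff[OF assms] algebra_simps)

lemma affine_map_linear_comp:
  assumes "linear j" "affine_map F"
  shows "affine_map (\<lambda>v. j (F v))"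
  using assms by (simp add: affine_map_def linear_add linear_scale)

lemma affine_map_comp_linear:
  assumes "affine_map G" "linear j"
  shows "affine_map (\<lambda>v. G (j v))"
  using assms by (simp add: affine_map_def linear_add linear_scale)

lemma affine_map_eq_on_span:
  assumes "affine_map F" "affine_map F'" "F 0 = F' 0"
    and "\<And>b. b \<in> B \<Longrightarrow> F b = F' b" and "span B = UNIV"
  shows "F = F'"
proof
  fix v
  have "F v - F 0 = F' v - F' 0"
    by (rule linear_eq_on_span[of "\<lambda>v. F v - F 0" "\<lambda>v. F' v - F' 0" B])
      (use assms affine_map_linear_part[of F] affine_map_linear_part[of F'] in auto)
  with assms(3) show "F v = F' v" by simp
qed


section \<open>Universal property of the free normed space\<close>

lemma free_normed_space_base: "free_normed_space pt e \<Longrightarrow> e pt = 0"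
  by (simp add: free_normed_space_def)

lemma affine_map_eq_on_free_normed_space:
  assumes "free_normed_space pt e" "affine_map F" "affine_map F'"
    and "\<And>x. F (e x) = F' (e x)"
  shows "F = F'"
proof (rule affine_map_eq_on_span[OF assms(2,3)])
  show "F 0 = F' 0" using assms(4)[of pt] free_normed_space_base[OF assms(1)] by simp
  show "span (e ` (- {pt})) = UNIV" using assms(1) by (simp add: free_normed_space_def)
qed (use assms(4) in auto)

lemma seminorm_norm_linear: "linear T \<Longrightarrow> seminorm (\<lambda>v. norm (T v))"
  by (simp add: seminorm_def linear_add linear_scale norm_triangle_ineq)

text \<open>
  The linear extension \<open>T\<close> is nonexpansive because \<open>v \<mapsto> norm (T v)\<close> is a seminorm on
  \<open>L(X, pt)\<close> that the largest one dominates, \<open>h\<close> being nonexpansive.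
\<close>

lemma free_normed_space_extend:
  fixes h :: "'a::metric_space \<Rightarrow> 'w::real_normed_vector"
    and e :: "'a \<Rightarrow> 'l::real_normed_vector"
  assumes "free_normed_space pt e" "h pt = 0"
    and "\<And>x y. dist (h x) (h y) \<le> dist x y"
  obtains T where "linear T" "\<And>x. T (e x) = h x" "\<And>v. norm (T v) \<le> norm v"
proof -
  have inj: "inj_on e (- {pt})" and ind: "independent (e ` (- {pt}))"
    and max: "\<And>q v. seminorm q \<Longrightarrow> (\<And>x y. q (e x - e y) \<le> dist x y) \<Longrightarrow> q v \<le> norm v"
    using assms(1) by (auto simp: free_normed_space_def)
  obtain T where T: "linear T" "\<forall>b\<in>e ` (- {pt}). T b = h (inv_into (- {pt}) e b)"
    using linear_independent_extend[OF ind, of "\<lambda>b. h (inv_into (- {pt}) e b)"] by blast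
  have Te: "T (e x) = h x" for x
  proof (cases "x = pt")
    case True
    then show ?thesis
      using assms(2) free_normed_space_base[OF assms(1)] linear_0[OF T(1)] by simp
  next
    case False
    then show ?thesis using T(2) inv_into_f_f[OF inj, of x] by simp
  qed
  moreover have "norm (T v) \<le> norm v" for v
    by (rule max[OF seminorm_norm_linear[OF T(1)]])
      (use assms(3) in \<open>simp add: linear_diff[OF T(1)] Te flip: dist_norm\<close>)
  ultimately show ?thesis using that T(1) by blast
qed

text \<open>Subtracting \<open>e (f pt)\<close> restores the base point, which \<open>f\<close> may move.\<close>

lemma free_normed_space_linearize:
  fixes e :: "'a::metric_space \<Rightarrow> 'l::real_normed_vector"
  assumes "free_normed_space pt e" and "\<And>x y. dist (f x) (f y) \<le> dist x y"
  obtains T where "linear T" "\<And>x. T (e x) = e (f x) - e (f pt)" "\<And>v. norm (T v) \<le> norm v"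
proof (rule free_normed_space_extend[OF assms(1), of "\<lambda>x. e (f x) - e (f pt)"])
  fix x y
  have "dist (e (f x) - e (f pt)) (e (f y) - e (f pt)) \<le> dist (f x) (f y)"
    using assms(1) by (simp add: free_normed_space_def dist_norm)
  also have "\<dots> \<le> dist x y" by (rule assms(2))
  finally show "dist (e (f x) - e (f pt)) (e (f y) - e (f pt)) \<le> dist x y" .
qed (use that in auto)

text \<open>
  On the points of \<open>X\<close> the terms \<open>e (g pt)\<close> cancel, leaving \<open>e x - e (g (f pt))\<close>, and
  \<open>e (g (f pt)) = e pt = 0\<close>.
\<close>

lemma free_normed_space_linearize_inverse:
  assumes free: "free_normed_space pt e"
    and T: "linear T" "\<And>x. T (e x) = e (f x) - e (f pt)"
    and S: "linear S" "\<And>x. S (e x) = e (g x) - e (g pt)"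
    and gf: "\<And>x. g (f x) = x"
  shows "S (T v) = v"
proof -
  have "linear (S \<circ> T)" by (rule linear_compose[OF T(1) S(1)])
  then have "affine_map (S \<circ> T)" using affine_map_translate_linear[of "S \<circ> T" 0] by (simp add: o_def)
  moreover have "affine_map id" by (simp add: affine_map_def)
  moreover have "(S \<circ> T) (e x) = id (e x)" for x
    by (simp add: T(2) S(2) linear_diff[OF S(1)] gf free_normed_space_base[OF free])
  ultimately have "S \<circ> T = id"
    by (rule affine_map_eq_on_free_normed_space[OF free])
  then show ?thesis by (metis comp_apply id_apply)
qed

lemma free_normed_space_affine_extension:
  fixes e :: "'a::metric_space \<Rightarrow> 'l::real_normed_vector"
  assumes free: "free_normed_space pt e" and f: "surjective_isometry f"
  obtains F where "surjective_isometry F" "affine_map F" "\<And>x. F (e x) = e (f x)"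
proof -
  have iso: "dist (f x) (f y) = dist x y" for x y
    using f by (simp add: surjective_isometry_def)
  define g where "g = inv f"
  have fg: "f (g y) = y" for y
    using f by (simp add: g_def surjective_isometry_def surj_f_inv_f)
  have gf: "g (f x) = x" for x
    using iso[of "g (f x)" x] fg[of "f x"] by simp
  have iso_g: "dist (g x) (g y) = dist x y" for x y
    using iso[of "g x" "g y"] by (simp add: fg)
  obtain T where T: "linear T" "\<And>x. T (e x) = e (f x) - e (f pt)" "\<And>v. norm (T v) \<le> norm v"
    using free_normed_space_linearize[OF free, of f] iso by auto
  obtain S where S: "linear S" "\<And>x. S (e x) = e (g x) - e (g pt)" "\<And>v. norm (S v) \<le> norm v"
    using free_normed_space_linearize[OF free, of g] iso_g by auto
  have ST: "S (T v) = v" for v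
    by (rule free_normed_space_linearize_inverse[OF free T(1,2) S(1,2) gf])
  have TS: "T (S v) = v" for v
    by (rule free_normed_space_linearize_inverse[OF free S(1,2) T(1,2) fg])
  have norm_T: "norm (T v) = norm v" for v
    using T(3)[of v] S(3)[of "T v"] by (simp add: ST)
  define F where "F v = e (f pt) + T v" for v
  have surj: "surj F"
    by (rule surjI[of _ "\<lambda>w. S (w - e (f pt))"]) (simp add: F_def TS)
  have "dist (F u) (F v) = dist u v" for u v
    using norm_T[of "u - v"] by (simp add: F_def dist_norm linear_diff[OF T(1)])
  with surj have "surjective_isometry F" by (simp add: surjective_isometry_def)
  moreover have "affine_map F"
    unfolding F_def by (rule affine_map_translate_linear[OF T(1)])
  moreover have "F (e x) = e (f x)" for x by (simp add: F_def T(2))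
  ultimately show ?thesis using that by blast
qed


section \<open>Extension of isometries from dense subsets\<close>

lemma continuous_eq_on_dense:
  fixes f g :: "'m::topological_space \<Rightarrow> 'n::t2_space"
  assumes "continuous_on UNIV f" "continuous_on UNIV g"
    and "closure S = UNIV" "\<And>x. x \<in> S \<Longrightarrow> f x = g x"
  shows "f = g"
proof -
  have "closure S \<subseteq> {x. f x = g x}"
    by (rule closure_minimal) (use assms closed_Collect_eq[of f g] in auto)
  then show ?thesis using assms(3) by auto
qed

lemma isometry_continuous_on:
  assumes "\<And>x y. dist (f x) (f y) = dist x y"
  shows "continuous_on S f"
  unfolding continuous_on_iff using assms by auto

text \<open>
  An isometry between dense subsets is given here by two embeddings of one space, so that exchanging
  \<open>j\<close> and \<open>k\<close> gives its inverse.  The extension exists by uniform continuity.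
\<close>

lemma isometry_extend_from_dense:
  fixes j :: "'l::metric_space \<Rightarrow> 'b::metric_space" and k :: "'l \<Rightarrow> 'c::complete_space"
  assumes j: "\<And>u v. dist (j u) (j v) = dist u v" and k: "\<And>u v. dist (k u) (k v) = dist u v"
    and dense: "closure (range j) = UNIV"
  obtains G where "\<And>v. G (j v) = k v" "\<And>x y. dist (G x) (G y) = dist x y"
proof -
  have "inj j" using j by (metis dist_eq_0_iff injI)
  then have inv: "inv j (j v) = v" for v by simp
  have "uniformly_continuous_on (range j) (\<lambda>x. k (inv j x))"
    unfolding uniformly_continuous_on_def by (auto simp: inv j k)
  from uniformly_continuous_on_extension_on_closure[OF this]
  obtain G where G: "uniformly_continuous_on UNIV G" "\<And>x. x \<in> range j \<Longrightarrow> k (inv j x) = G x"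
    using dense by metis
  have Gj: "G (j v) = k v" for v using G(2)[of "j v"] by (simp add: inv)
  have cont: "continuous_on UNIV G"
    using G(1) by (rule uniformly_continuous_imp_continuous)
  have contG: "continuous_on UNIV (\<lambda>x. dist (G x) (G y))" for y
    using cont by (intro continuous_intros)
  have cont_dist: "continuous_on UNIV (\<lambda>x. dist x y)" for y :: 'b
    by (intro continuous_intros)
  \<comment> \<open>Distances are preserved by density, first in one argument and then in the other.\<close>
  have half: "(\<lambda>x. dist (G x) (G (j v))) = (\<lambda>x. dist x (j v))" for v
    by (rule continuous_eq_on_dense[OF contG cont_dist dense]) (auto simp: Gj j k)
  have "(\<lambda>x. dist (G x) (G y)) = (\<lambda>x. dist x y)" for y
  proof (rule continuous_eq_on_dense[OF contG cont_dist dense])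
    fix x assume "x \<in> range j"
    then show "dist (G x) (G y) = dist x y" using fun_cong[OF half] by (metis dist_commute imageE)
  qed
  then have "dist (G x) (G y) = dist x y" for x y by metis
  with Gj that show ?thesis by blast
qed

text \<open>Surjectivity: the extension of the inverse isometry is a right inverse, by density.\<close>

lemma surjective_isometry_extend_from_dense:
  fixes j :: "'l::metric_space \<Rightarrow> 'b::complete_space" and k :: "'l \<Rightarrow> 'c::complete_space"
  assumes j: "\<And>u v. dist (j u) (j v) = dist u v" and k: "\<And>u v. dist (k u) (k v) = dist u v"
    and dense: "closure (range j) = UNIV" "closure (range k) = UNIV"
  obtains G where "\<And>v. G (j v) = k v" "surjective_isometry G"
proof -
  obtain G where G: "\<And>v. G (j v) = k v" "\<And>x y. dist (G x) (G y) = dist x y"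
    using isometry_extend_from_dense[OF j k dense(1)] by blast
  obtain H where H: "\<And>v. H (k v) = j v" "\<And>x y. dist (H x) (H y) = dist x y"
    using isometry_extend_from_dense[OF k j dense(2)] by blast
  have "(\<lambda>x. G (H x)) = (\<lambda>x. x)"
  proof (rule continuous_eq_on_dense[OF _ _ dense(2)])
    show "continuous_on UNIV (\<lambda>x. G (H x))"
      by (rule isometry_continuous_on) (simp add: G(2) H(2))
  qed (auto simp: G(1) H(1))
  then have "surj G" by (metis surjI)
  then have "surjective_isometry G" by (simp add: surjective_isometry_def G(2))
  with G(1) that show ?thesis by blast
qed

lemma affine_map_from_dense:
  fixes j :: "'l::real_vector \<Rightarrow> 'b::real_normed_vector" and G :: "'b \<Rightarrow> 'c::real_normed_vector"
  assumes j: "linear j" "closure (range j) = UNIV"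
    and G: "continuous_on UNIV G" "affine_map (\<lambda>v. G (j v))"
  shows "affine_map G"
proof -
  have on_range: "G ((1 - t) *\<^sub>R j u + t *\<^sub>R j v) = (1 - t) *\<^sub>R G (j u) + t *\<^sub>R G (j v)" for u v t
    using G(2) j(1) by (simp add: affine_map_def linear_add linear_scale)
  have GC: "continuous_on UNIV (\<lambda>x. G (h x))" if "continuous_on UNIV h" for h :: "'b \<Rightarrow> 'b"
    using continuous_on_compose2[OF G(1) that] by simp
  have half: "(\<lambda>x. G ((1 - t) *\<^sub>R x + t *\<^sub>R j v)) = (\<lambda>x. (1 - t) *\<^sub>R G x + t *\<^sub>R G (j v))" for t v
    by (rule continuous_eq_on_dense[OF _ _ j(2)])
      (auto simp: on_range intro!: GC continuous_intros G(1))
  have "(\<lambda>y. G ((1 - t) *\<^sub>R x + t *\<^sub>R y)) = (\<lambda>y. (1 - t) *\<^sub>R G x + t *\<^sub>R G y)" for t x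
    by (rule continuous_eq_on_dense[OF _ _ j(2)])
      (auto simp: fun_cong[OF half] intro!: GC continuous_intros G(1))
  then show ?thesis unfolding affine_map_def by metis
qed


section \<open>Banach completions\<close>

lemma banach_completion_dist:
  assumes "banach_completion j"
  shows "dist (j u) (j v) = dist u v"
proof -
  have "j u - j v = j (u - v)"
    using assms linear_diff[of j u v] by (simp add: banach_completion_def)
  then show ?thesis using assms by (simp add: banach_completion_def dist_norm)
qed

lemma banach_completion_affine_extension:
  fixes j :: "'l::real_normed_vector \<Rightarrow> 'b::banach"
  assumes j: "banach_completion j" and F: "surjective_isometry F" "affine_map F"
  obtains G where "surjective_isometry G" "affine_map G" "\<And>v. G (j v) = j (F v)"
proof -
  have lin: "linear j" and dense: "closure (range j) = UNIV"
    using j by (auto simp: banach_completion_def)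
  have range_jF: "range (\<lambda>v. j (F v)) = range j"
    using F(1) by (auto simp: surjective_isometry_def simp flip: image_image)
  obtain G where G: "\<And>v. G (j v) = j (F v)" "surjective_isometry G"
    by (rule surjective_isometry_extend_from_dense[of j "\<lambda>v. j (F v)"])
      (use F(1) dense in \<open>auto simp: banach_completion_dist[OF j] range_jF surjective_isometry_def\<close>)
  have "affine_map G"
  proof (rule affine_map_from_dense[OF lin dense])
    show "continuous_on UNIV G"
      using G(2) by (intro isometry_continuous_on) (simp add: surjective_isometry_def)
    show "affine_map (\<lambda>v. G (j v))"
      using affine_map_linear_comp[OF lin F(2)] by (simp add: G(1))
  qed
  with G that show ?thesis by blast
qed

lemma affine_isometry_eq_on_completion:
  fixes e :: "'a::metric_space \<Rightarrow> 'l::real_normed_vector" and j :: "'l \<Rightarrow> 'b::banach"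
  assumes free: "free_normed_space pt e" and j: "banach_completion j"
    and G: "surjective_isometry G" "affine_map G"
    and G': "surjective_isometry G'" "affine_map G'"
    and eq: "\<And>x. G (j (e x)) = G' (j (e x))"
  shows "G = G'"
proof -
  have lin: "linear j" and dense: "closure (range j) = UNIV"
    using j by (auto simp: banach_completion_def)
  have "(\<lambda>v. G (j v)) = (\<lambda>v. G' (j v))"
    by (rule affine_map_eq_on_free_normed_space[OF free])
      (use eq G(2) G'(2) lin in \<open>auto intro: affine_map_comp_linear\<close>)
  then have on_range: "G y = G' y" if "y \<in> range j" for y using that by (metis imageE)
  have "continuous_on UNIV G" "continuous_on UNIV G'"
    using G(1) G'(1) by (auto simp: surjective_isometry_def intro: isometry_continuous_on)
  then show ?thesis using continuous_eq_on_dense[OF _ _ dense] on_range by blast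
qed


section \<open>Extension of surjective isometries\<close>

theorem corollary5p4:
  fixes pt :: "'a::metric_space"
    and e :: "'a \<Rightarrow> 'l::real_normed_vector"
    and j :: "'l \<Rightarrow> 'b::banach"
    and f :: "'a \<Rightarrow> 'a"
  assumes "free_normed_space pt e"
    and "banach_completion j"
    and "surjective_isometry f"
  shows "(\<exists>!F :: 'l \<Rightarrow> 'l.
            surjective_isometry F \<and> affine_map F \<and> (\<forall>x. F (e x) = e (f x))) \<and>
         (\<exists>!G :: 'b \<Rightarrow> 'b.
            surjective_isometry G \<and> affine_map G \<and> (\<forall>x. G (j (e x)) = j (e (f x))))"
proof -
  obtain F where F: "surjective_isometry F" "affine_map F" "\<And>x. F (e x) = e (f x)"
    using free_normed_space_affine_extension[OF assms(1,3)] by blast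
  obtain G where G: "surjective_isometry G" "affine_map G" "\<And>v. G (j v) = j (F v)"
    using banach_completion_affine_extension[OF assms(2) F(1,2)] by blast
  have "\<exists>!F. surjective_isometry F \<and> affine_map F \<and> (\<forall>x. F (e x) = e (f x))"
  proof (rule ex1I[of _ F])
    fix F' assume "surjective_isometry F' \<and> affine_map F' \<and> (\<forall>x. F' (e x) = e (f x))"
    then show "F' = F"
      using F by (intro affine_map_eq_on_free_normed_space[OF assms(1)]) auto
  qed (use F in auto)
  moreover have "\<exists>!G. surjective_isometry G \<and> affine_map G \<and> (\<forall>x. G (j (e x)) = j (e (f x)))"
  proof (rule ex1I[of _ G])
    fix G' assume "surjective_isometry G' \<and> affine_map G' \<and> (\<forall>x. G' (j (e x)) = j (e (f x)))"
    then show "G' = G"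
      using F G by (intro affine_isometry_eq_on_completion[OF assms(1,2)]) auto
  qed (use F G in auto)
  ultimately show ?thesis by blast
qed

end
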